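(* Let $f:[0,1]^3\to\mathbb R$ be given by $f(x_1,x_2,x_3)=x_1+(1-x_1-x_2+x_1x_2)\,x_3$. For every $x_1,x_2,x_3\in[0,1]$ there exists a probability distribution $(p_0,\dots,p_7)$ on $\{0,1\}^3$ (characteristic of an $L$-ensemble) such that $$x_1=p_4+p_5+p_6+p_7,\quad x_2=p_2+p_3+p_6+p_7,\quad x_3=p_1+p_3+p_5+p_7,$$ and $$z:=p_1+p_4+p_5+p_6+p_7=f(x_1,x_2,x_3).$$
   Formalization: An L-ensemble gives the empty set positive mass, so its marginals are below 1 and the claim fails when some x_i = 1; here the distribution is an L-ensemble when all x_i < 1 and, in every case, a pointwise limit of L-ensembles (read as determinantal, L symmetric positive semidefinite). *)

theory Defs
  imports "HOL-Analysis.Analysis"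
begin

definition f :: "real^3 \<Rightarrow> real" where
  "f x = x$1 + (1 - x$1 - x$2 + x$1 * x$2) * x$3"

text \<open>Determinant of the submatrix of \<open>L\<close> with rows and columns in \<open>A\<close>: the Leibniz formula by
  which \<^const>\<open>det\<close> is defined, with the index set \<open>UNIV\<close> replaced by \<open>A\<close>. The empty minor is 1.\<close>

definition principal_minor :: "real^'n^'n \<Rightarrow> 'n::finite set \<Rightarrow> real" where
  "principal_minor L A = (\<Sum>\<pi> | \<pi> permutes A. of_int (sign \<pi>) * (\<Prod>i\<in>A. L $ i $ \<pi> i))"

lemma principal_minor_UNIV: "principal_minor L UNIV = det L"
  by (simp add: principal_minor_def det_def)

lemma principal_minor_empty: "principal_minor L {} = 1"
  by (simp add: principal_minor_def)

definition pos_semidef :: "real^'n^'n \<Rightarrow> bool" where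
  "pos_semidef L \<longleftrightarrow> transpose L = L \<and> (\<forall>v. 0 \<le> v \<bullet> (L *v v))"

text \<open>The outcome \<open>(b\<^sub>1, b\<^sub>2, b\<^sub>3) \<in> {0,1}\<^sup>3\<close> has index \<open>4 * b\<^sub>1 + 2 * b\<^sub>2 + b\<^sub>3\<close> and is identified
  with the set of those \<open>j\<close> for which \<open>b\<^sub>j = 1\<close>. In the type \<^typ>\<open>3\<close> the numeral 3 denotes
  the element 0.\<close>

definition outcome :: "nat \<Rightarrow> 3 set" where
  "outcome i = {j. j = 1 \<and> odd (i div 4) \<or> j = 2 \<and> odd (i div 2) \<or> j = 3 \<and> odd i}"

definition prob_distribution :: "(nat \<Rightarrow> real) \<Rightarrow> bool" where
  "prob_distribution p \<longleftrightarrow> (\<forall>i<8. 0 \<le> p i) \<and> (\<Sum>i<8. p i) = 1"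

definition L_ensemble :: "(nat \<Rightarrow> real) \<Rightarrow> bool" where
  "L_ensemble p \<longleftrightarrow> (\<exists>L :: real^3^3. pos_semidef L \<and>
     (\<forall>i<8. p i = principal_minor L (outcome i) / det (mat 1 + L)))"

definition limit_of_L_ensembles :: "(nat \<Rightarrow> real) \<Rightarrow> bool" where
  "limit_of_L_ensembles p \<longleftrightarrow> (\<exists>q :: nat \<Rightarrow> nat \<Rightarrow> real. (\<forall>n. L_ensemble (q n)) \<and>
     (\<forall>i<8. (\<lambda>n. q n i) \<longlonglongrightarrow> p i))"

text \<open>An \<open>L\<close>-ensemble gives positive mass to the empty set, so each of its one-point marginals is
  strictly below 1. Hence on the faces \<open>x\<^sub>i = 1\<close> of the cube only limits of \<open>L\<close>-ensembles can occur.\<close>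

lemma L_ensemble_empty_pos:
  assumes "prob_distribution p" "L_ensemble p"
  shows "0 < p 0"
proof (rule ccontr)
  assume "\<not> 0 < p 0"
  moreover have "0 \<le> p 0" using assms(1) by (auto simp: prob_distribution_def)
  ultimately have p0: "p 0 = 0" by simp
  obtain L :: "real^3^3" where
    L: "\<And>i. i < 8 \<Longrightarrow> p i = principal_minor L (outcome i) / det (mat 1 + L)"
    using assms(2) by (auto simp: L_ensemble_def)
  have "outcome 0 = {}" by (simp add: outcome_def)
  hence "det (mat 1 + L) = 0" using L[of 0] p0 by (simp add: principal_minor_empty)
  hence "\<forall>i<8. p i = 0" using L by simp
  hence "(\<Sum>i<8. p i) = 0" by simp
  thus False using assms(1) by (simp add: prob_distribution_def)
qed

lemma L_ensemble_marginals_less_1: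
  assumes "prob_distribution p" "L_ensemble p"
  shows "p 4 + p 5 + p 6 + p 7 < 1" "p 2 + p 3 + p 6 + p 7 < 1" "p 1 + p 3 + p 5 + p 7 < 1"
proof -
  have s: "p 0 + p 1 + p 2 + p 3 + p 4 + p 5 + p 6 + p 7 = 1"
    using assms(1) by (simp add: prob_distribution_def eval_nat_numeral)
  have nn: "0 \<le> p 1" "0 \<le> p 2" "0 \<le> p 3" "0 \<le> p 4" "0 \<le> p 5" "0 \<le> p 6" "0 \<le> p 7"
    using assms(1) by (auto simp: prob_distribution_def)
  note pos = L_ensemble_empty_pos[OF assms]
  show "p 4 + p 5 + p 6 + p 7 < 1" "p 2 + p 3 + p 6 + p 7 < 1" "p 1 + p 3 + p 5 + p 7 < 1"
    using s nn pos by linarith+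
qed

end

theory Submission
  imports Defs
begin

text \<open>Take the three coordinates independent with means \<open>x\<^sub>j\<close>: then \<open>z\<close> is the probability of
  \<open>b\<^sub>1 = 1\<close> plus that of \<open>(0, 0, 1)\<close>, i.e. \<open>x\<^sub>1 + (1 - x\<^sub>1) (1 - x\<^sub>2) x\<^sub>3\<close>. Independent
  coordinates with means below 1 form the \<open>L\<close>-ensemble of the diagonal matrix of odds
  \<open>x\<^sub>j / (1 - x\<^sub>j)\<close>, and scaling \<open>x\<close> by \<open>n / (n + 1)\<close> approximates means equal to 1.\<close>

text \<open>A permutation of \<open>A\<close> other than \<open>id\<close> moves some point, which
  must lie in \<open>A\<close>, so its Leibniz term contains an off-diagonal factor 0. Only the term
  of \<open>id\<close> survives.\<close>

lemma principal_minor_diagonal: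
  fixes L :: "real^'n^'n"
  assumes diag: "\<And>i j. i \<noteq> j \<Longrightarrow> L $ i $ j = 0"
  shows "principal_minor L A = (\<Prod>i\<in>A. L $ i $ i)"
proof -
  have "principal_minor L A =
      (\<Sum>\<pi>\<in>{id}. of_int (sign \<pi>) * (\<Prod>i\<in>A. L $ i $ \<pi> i))"
    unfolding principal_minor_def
  proof (rule sum.mono_neutral_right)
    show "finite {\<pi>. \<pi> permutes A}" by (simp add: finite_permutations)
    show "{id} \<subseteq> {\<pi>. \<pi> permutes A}" by (simp add: permutes_id)
    show "\<forall>\<pi>\<in>{\<pi>. \<pi> permutes A} - {id}.
        of_int (sign \<pi>) * (\<Prod>i\<in>A. L $ i $ \<pi> i) = 0"
    proof
      fix \<pi> assume \<pi>: "\<pi> \<in> {\<pi>. \<pi> permutes A} - {id}"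
      then obtain i where "\<pi> i \<noteq> i" by (auto simp: fun_eq_iff)
      with \<pi> have "i \<in> A" "L $ i $ \<pi> i = 0"
        using diag[of i "\<pi> i"] by (auto simp: permutes_def)
      then have "(\<Prod>i\<in>A. L $ i $ \<pi> i) = 0" by (intro prod_zero) auto
      then show "of_int (sign \<pi>) * (\<Prod>i\<in>A. L $ i $ \<pi> i) = 0" by simp
    qed
  qed
  then show ?thesis by simp
qed

text \<open>The quadratic form is a sum of squares weighted by the diagonal entries.\<close>

lemma pos_semidef_diagonal:
  fixes L :: "real^'n^'n"
  assumes diag: "\<And>i j. i \<noteq> j \<Longrightarrow> L $ i $ j = 0" and nonneg: "\<And>i. 0 \<le> L $ i $ i"
  shows "pos_semidef L"
  unfolding pos_semidef_def
proof (intro conjI allI)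
  show "transpose L = L"
    unfolding vec_eq_iff transpose_def using diag by (metis vec_lambda_beta)
  fix v :: "real^'n"
  have "(L *v v) $ i = L $ i $ i * v $ i" for i
  proof -
    have "(L *v v) $ i = (\<Sum>j\<in>UNIV. if j = i then L $ i $ i * v $ i else 0)"
      unfolding matrix_vector_mult_def vec_lambda_beta
      by (rule sum.cong) (use diag[of i] in auto)
    then show ?thesis by simp
  qed
  then have "v \<bullet> (L *v v) = (\<Sum>i\<in>UNIV. L $ i $ i * (v $ i)\<^sup>2)"
    by (simp add: inner_vec_def power2_eq_square mult_ac)
  then show "0 \<le> v \<bullet> (L *v v)" using nonneg by (simp add: sum_nonneg)
qed

definition independent :: "real^3 \<Rightarrow> nat \<Rightarrow> real" where
  "independent x i = (\<Prod>j\<in>UNIV. if j \<in> outcome i then x $ j else 1 - x $ j)"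

text \<open>With odds on the diagonal, each factor of \<open>det (mat 1 + L)\<close> is
  \<open>1 / (1 - x $ j)\<close>. Dividing by it turns the odds into \<open>x $ j\<close> for
  \<open>j\<close> in the outcome, and 1 into \<open>1 - x $ j\<close> for the other
  \<open>j\<close>.\<close>

lemma L_ensemble_independent:
  assumes "\<And>j. 0 \<le> x $ j" "\<And>j. x $ j < 1"
  shows "L_ensemble (independent x)"
proof -
  define L :: "real^3^3" where "L = (\<chi> i j. if i = j then x $ i / (1 - x $ i) else 0)"
  have less: "1 - x $ j > 0" for j using assms(2)[of j] by simp
  have ne: "1 - x $ j \<noteq> 0" for j using less[of j] by simp
  have "pos_semidef L"
    using assms(1) less by (intro pos_semidef_diagonal) (auto simp: L_def less_imp_le)
  moreover have "independent x i = principal_minor L (outcome i) / det (mat 1 + L)" for i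
  proof -
    have "det (mat 1 + L) = (\<Prod>j\<in>UNIV. 1 + x $ j / (1 - x $ j))"
      by (subst det_diagonal) (auto simp: L_def mat_def)
    moreover have "principal_minor L (outcome i) = (\<Prod>j\<in>outcome i. x $ j / (1 - x $ j))"
      by (subst principal_minor_diagonal) (auto simp: L_def)
    \<comment> \<open>Padding the minor with ones gives both products the index set
      \<open>UNIV\<close>, so that the quotient can be taken factor by factor.\<close>
    moreover have "\<dots> = (\<Prod>j\<in>UNIV. if j \<in> outcome i then x $ j / (1 - x $ j) else 1)"
      by (simp add: prod.If_cases)
    ultimately have "principal_minor L (outcome i) / det (mat 1 + L) =
        (\<Prod>j\<in>UNIV. (if j \<in> outcome i then x $ j / (1 - x $ j) else 1) / (1 + x $ j / (1 - x $ j)))"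
      by (simp add: prod_dividef)
    also have "\<dots> = independent x i"
      unfolding independent_def using ne by (intro prod.cong) (auto simp: field_simps)
    finally show ?thesis by simp
  qed
  ultimately show ?thesis by (auto simp: L_ensemble_def)
qed

lemma limit_of_L_ensembles_independent:
  assumes "\<And>j. 0 \<le> x $ j" "\<And>j. x $ j \<le> 1"
  shows "limit_of_L_ensembles (independent x)"
  unfolding limit_of_L_ensembles_def
proof (intro exI conjI allI impI)
  \<comment> \<open>Strictly below 1 for every \<open>n\<close>, so the scaled means avoid the faces
    where the odds are undefined; at \<open>n = 0\<close> all means are 0.\<close>
  define c where "c n = real n / real (Suc n)" for n
  have c: "0 \<le> c n" "c n < 1" for n by (auto simp: c_def)
  show "L_ensemble (independent (c n *\<^sub>R x))" for n
  proof (rule L_ensemble_independent)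
    fix j
    show "0 \<le> (c n *\<^sub>R x) $ j" using assms(1) c by simp
    have "c n * x $ j \<le> c n" using assms(2) c by (simp add: mult_left_le)
    then show "(c n *\<^sub>R x) $ j < 1" using c(2)[of n] by simp
  qed
  fix i
  have lim: "(\<lambda>n. (c n *\<^sub>R x) $ j) \<longlonglongrightarrow> x $ j" for j
    using tendsto_mult[OF LIMSEQ_n_over_Suc_n tendsto_const, of "x $ j"] by (simp add: c_def)
  show "(\<lambda>n. independent (c n *\<^sub>R x) i) \<longlonglongrightarrow> independent x i"
    \<comment> \<open>Each probability is a finite product of factors continuous in
      \<open>x\<close>, so convergence of the means suffices.\<close>
    unfolding independent_def
  proof (rule tendsto_prod)
    fix j
    show "(\<lambda>n. if j \<in> outcome i then (c n *\<^sub>R x) $ j else 1 - (c n *\<^sub>R x) $ j)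
        \<longlonglongrightarrow> (if j \<in> outcome i then x $ j else 1 - x $ j)"
      using lim[of j] tendsto_diff[OF tendsto_const lim[of j]] by (cases "j \<in> outcome i") simp_all
  qed
qed

lemma mem_outcome:
  "1 \<in> outcome i \<longleftrightarrow> odd (i div 4)"
  "2 \<in> outcome i \<longleftrightarrow> odd (i div 2)"
  "3 \<in> outcome i \<longleftrightarrow> odd i"
  by (simp_all add: outcome_def)

lemma independent_eq:
  "independent x i = (if odd (i div 4) then x$1 else 1 - x$1) *
     (if odd (i div 2) then x$2 else 1 - x$2) * (if odd i then x$3 else 1 - x$3)"
proof -
  have "(\<Prod>j\<in>UNIV. g j) = g 1 * g 2 * g 3" for g :: "3 \<Rightarrow> real"
    unfolding UNIV_3 by (simp add: mult_ac)
  then show ?thesis unfolding independent_def by (simp only: mem_outcome)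
qed

lemma independent_values:
  "independent x 0 = (1 - x$1) * (1 - x$2) * (1 - x$3)"
  "independent x 1 = (1 - x$1) * (1 - x$2) * x$3"
  "independent x 2 = (1 - x$1) * x$2 * (1 - x$3)"
  "independent x 3 = (1 - x$1) * x$2 * x$3"
  "independent x 4 = x$1 * (1 - x$2) * (1 - x$3)"
  "independent x 5 = x$1 * (1 - x$2) * x$3"
  "independent x 6 = x$1 * x$2 * (1 - x$3)"
  "independent x 7 = x$1 * x$2 * x$3"
  by (simp_all add: independent_eq)

theorem theorem4:
  fixes x :: "real^3"
  assumes "\<forall>i. x$i \<in> {0..1}"
  shows "\<exists>p :: nat \<Rightarrow> real.
           prob_distribution p \<and>
           ((\<forall>i. x$i < 1) \<longrightarrow> L_ensemble p) \<and>
           limit_of_L_ensembles p \<and>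
           x$1 = p 4 + p 5 + p 6 + p 7 \<and>
           x$2 = p 2 + p 3 + p 6 + p 7 \<and>
           x$3 = p 1 + p 3 + p 5 + p 7 \<and>
           p 1 + p 4 + p 5 + p 6 + p 7 = f x"
\<comment> \<open>The witness stays schematic here; the first \<open>show\<close> fixes it to
  \<open>independent x\<close>.\<close>
proof (intro exI conjI impI)
  have x: "0 \<le> x $ j" "x $ j \<le> 1" for j using assms by auto
  have "(\<Sum>i<8. independent x i) = independent x 0 + independent x 1 + independent x 2
      + independent x 3 + independent x 4 + independent x 5 + independent x 6 + independent x 7"
    by (simp add: eval_nat_numeral)
  \<comment> \<open>The eight terms are the expansion of the product of the sums
    \<open>x $ j + (1 - x $ j)\<close>.\<close>
  also have "\<dots> = 1" unfolding independent_values by (simp add: algebra_simps)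
  finally have "(\<Sum>i<8. independent x i) = 1" .
  moreover have "0 \<le> independent x i" for i
    unfolding independent_def using x by (intro prod_nonneg) auto
  ultimately show "prob_distribution (independent x)" by (simp add: prob_distribution_def)
  show "L_ensemble (independent x)" if "\<forall>i. x$i < 1"
    using that x by (simp add: L_ensemble_independent)
  show "limit_of_L_ensembles (independent x)"
    using x by (rule limit_of_L_ensembles_independent)
\<comment> \<open>What remains are polynomial identities: three marginals, and the value of
  \<open>f\<close>, where \<open>p 4\<close> to \<open>p 7\<close> add up to \<open>x$1\<close> and
  \<open>p 1\<close> is \<open>(1 - x$1) * (1 - x$2) * x$3\<close>.\<close>
qed (unfold independent_values f_def, simp_all add: algebra_simps)

end
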